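(* Let $n\ge1$ and $r\ge0$ be integers and let $x$ be an integer. Then $$(2r+1)\prod_{k=-r}^r(x+k)(x+1-k)\sum_{k=0}^{n-1}(2k+2r+1)d_k^{(r)}(x)^2\equiv 0\pmod{2n^2(n+1)^2\cdots(n+2r)^2}.$$
   Context: For a complex number $a$ and integer $k\ge0$, $\binom{a}{k}=a(a-1)\cdots(a-k+1)/k!$. For a parameter $r$ and an integer $n\ge 0$, $d_n^{(r)}(x)=\sum_{k=0}^n\binom{x+r+k}{k}\binom{x-r}{n-k}$ (this is an integer when $x,r$ are integers). *)

theory Defs
  imports Complex_Main "HOL-Number_Theory.Cong"
begin

definition d :: "complex \<Rightarrow> nat \<Rightarrow> complex \<Rightarrow> complex" where
  "d r n x = (\<Sum>k=0..n. ((x + r + of_nat k) gchoose k) * ((x - r) gchoose (n - k)))"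

lemma d_of_int_in_Ints: "d (of_int r) n (of_int x) \<in> \<int>"
proof -
  have gbinomial_Ints: "(of_int a :: complex) gchoose k \<in> \<int>" for a k
    unfolding of_int_gbinomial [symmetric] by (rule Ints_of_int)
  have "(of_int x + of_int r + of_nat k :: complex) gchoose k \<in> \<int>" for k
    using gbinomial_Ints [of "x + r + int k" k] by simp
  moreover have "(of_int x - of_int r :: complex) gchoose k \<in> \<int>" for k
    using gbinomial_Ints [of "x - r" k] by simp
  ultimately show ?thesis
    unfolding d_def by (intro Ints_sum Ints_mult)
qed

(* For integers x and r the value of d is an integer; d_int is that integer, so that congruences
   can be stated with cong on int. *)
definition d_int :: "int \<Rightarrow> nat \<Rightarrow> int \<Rightarrow> int" where
  "d_int r n x = (THE z. of_int z = d (of_int r) n (of_int x))"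

lemma of_int_d_int: "of_int (d_int r n x) = d (of_int r) n (of_int x)"
proof -
  obtain z where "d (of_int r) n (of_int x) = of_int z"
    using d_of_int_in_Ints by (rule Ints_cases)
  then show ?thesis by (simp add: d_int_def)
qed

end

theory Submission
  imports Defs "HOL-Computational_Algebra.Formal_Power_Series"
begin

text \<open>
  Dividing \<open>d r n x\<close> by \<open>binomial (n + 2 * r) n\<close> gives a terminating hypergeometric series whose
  square is again a single hypergeometric sum over \<open>j\<close>, with summands that are polynomials in
  \<open>n * (n + 2 * r + 1)\<close> and in \<open>x * (x + 1)\<close>. The weights \<open>2 * k + 2 * r + 1\<close> make the sum over \<open>k\<close>
  telescope for each \<open>j\<close>. After division by \<open>n\<^sup>2 * \<dots> * (n + 2 * r)\<^sup>2\<close> and multiplication by the product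
  over \<open>k\<close>, the \<open>j\<close>-th term becomes \<open>4 ^ j\<close> times a quotient of products of factorials, which is
  an integer by Legendre's formula and an inequality between floors. The reflection
  \<open>x \<mapsto> - 1 - x\<close> reduces everything to \<open>x > r\<close>, because the product over \<open>k\<close> vanishes for
  \<open>- r - 1 \<le> x \<le> r\<close>.
\<close>

section \<open>A quotient of factorials\<close>

lemma multiplicity_eq_card:
  fixes p m :: nat
  assumes "prime p" "0 < m" "m \<le> M"
  shows "multiplicity p m = card {i \<in> {1..M}. p ^ i dvd m}"
proof -
  have "i \<le> M" if "p ^ i dvd m" for i
  proof -
    have "i < p ^ i" by (rule power_gt_expt) (use prime_gt_1_nat[OF assms(1)] in simp)
    also have "\<dots> \<le> m" using that assms(2) by (rule dvd_imp_le)
    finally show ?thesis using assms(3) by simp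
  qed
  moreover have "p ^ i dvd m \<longleftrightarrow> i \<le> multiplicity p m" for i
    using assms by (intro power_dvd_iff_le_multiplicity) (auto simp: prime_gt_0_nat)
  ultimately have "{i \<in> {1..M}. p ^ i dvd m} = {1..multiplicity p m}"
    by auto
  then show ?thesis by simp
qed

lemma Suc_div_eq: "Suc n div q = n div q + (if q dvd Suc n then 1 else 0)"
  by (simp add: div_Suc dvd_eq_mod_eq_0)

text \<open>Passing from \<open>n\<close> to \<open>Suc n\<close> raises \<open>n div p ^ i\<close>
  by one exactly when \<open>p ^ i\<close> divides \<open>Suc n\<close>. The free cutoff
  \<open>M\<close> lets several factorials be compared termwise over one range of exponents.\<close>

lemma multiplicity_fact:
  fixes p :: nat
  assumes "prime p" "n \<le> M"
  shows "multiplicity p (fact n :: nat) = (\<Sum>i = 1..M. n div p ^ i)"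
  using assms(2)
proof (induction n)
  case (Suc n)
  have "multiplicity p (fact (Suc n) :: nat) = multiplicity p (Suc n) + multiplicity p (fact n :: nat)"
    using assms(1) by (simp add: prime_elem_multiplicity_mult_distrib del: mult_Suc)
  also have "multiplicity p (Suc n) = (\<Sum>i = 1..M. if p ^ i dvd Suc n then 1 else 0)"
    using multiplicity_eq_card[OF assms(1), of "Suc n" M] Suc.prems
    by (simp add: sum.If_cases Int_def)
  finally show ?case using Suc by (simp add: Suc_div_eq sum.distrib)
qed simp

section \<open>A floor inequality and the resulting divisibility\<close>

lemma int_div_cases:
  fixes Q e :: int
  assumes "0 < Q" "- Q \<le> e" "e < 3 * Q"
  shows "(e div Q = -1 \<and> e < 0) \<or> (e div Q = 0 \<and> 0 \<le> e \<and> e < Q)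
    \<or> (e div Q = 1 \<and> Q \<le> e \<and> e < 2 * Q) \<or> (e div Q = 2 \<and> 2 * Q \<le> e)"
proof -
  have eq: "e div Q = c" if "c * Q \<le> e" "e < c * Q + Q" for c
    using that by (intro int_div_pos_eq[of _ _ _ "e - c * Q"]) (auto simp: mult.commute)
  consider "e < 0" | "0 \<le> e" "e < Q" | "Q \<le> e" "e < 2 * Q" | "2 * Q \<le> e" by linarith
  then show ?thesis
    using assms eq[of "-1"] eq[of 0] eq[of 1] eq[of 2] by cases auto
qed

text \<open>Separate the terms containing \<open>N\<close> from those containing \<open>y\<close>. At the modulus \<open>Q\<close> the former can lose a factor only if
  \<open>Q \<le> s + j\<close> and \<open>s + 2 * j < 2 * Q\<close>; the latter then gains one.\<close>

lemma floor_sum_ineq_residues: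
  fixes Q y s N j :: int
  assumes "0 \<le> y" "y < Q" "0 \<le> s" "s < Q" "0 \<le> N" "N < Q" "0 \<le> j" "j < Q"
  shows "(y - 1) div Q + (s - 1 + 2 * j) div Q + (y - j) div Q + (N + s) div Q
          + (N - j) div Q + (s + j) div Q
         \<le> (y + s) div Q + (y + s - 1 + j) div Q + (N + s + j) div Q"
proof -
  have Q: "0 < Q" using assms by simp
  obtain g :: int where g: "g = 1 \<and> Q \<le> s + j \<and> s + 2 * j < 2 * Q
      \<or> g = 0 \<and> s + j < Q \<or> g = 0 \<and> 2 * Q \<le> s + 2 * j"
    by (metis linorder_not_le)
  have N_part: "b1 + b2 + b3 - a \<le> g"
    if "b1 = 0 \<and> N + s < Q \<or> b1 = 1 \<and> Q \<le> N + s"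
      "b2 = -1 \<and> N < j \<or> b2 = 0 \<and> j \<le> N"
      "b3 = 0 \<and> s + j < Q \<or> b3 = 1 \<and> Q \<le> s + j"
      "a = 0 \<and> N + s + j < Q \<or> a = 1 \<and> Q \<le> N + s + j \<and> N + s + j < 2 * Q
        \<or> a = 2 \<and> 2 * Q \<le> N + s + j"
    for b1 b2 b3 a :: int
    using assms g that by (elim disjE conjE) linarith+
  have y_part: "b1 + b2 + b3 + g \<le> a1 + a2"
    if "b1 = -1 \<and> y = 0 \<or> b1 = 0 \<and> 0 < y"
      "b3 = -1 \<and> y < j \<or> b3 = 0 \<and> j \<le> y"
      "a1 = 0 \<and> y + s < Q \<or> a1 = 1 \<and> Q \<le> y + s"
      "b2 = -1 \<and> s - 1 + 2 * j < 0 \<or> b2 = 0 \<and> 0 \<le> s - 1 + 2 * j \<and> s - 1 + 2 * j < Q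
        \<or> b2 = 1 \<and> Q \<le> s - 1 + 2 * j \<and> s - 1 + 2 * j < 2 * Q \<or> b2 = 2 \<and> 2 * Q \<le> s - 1 + 2 * j"
      "a2 = -1 \<and> y + s - 1 + j < 0 \<or> a2 = 0 \<and> 0 \<le> y + s - 1 + j \<and> y + s - 1 + j < Q
        \<or> a2 = 1 \<and> Q \<le> y + s - 1 + j \<and> y + s - 1 + j < 2 * Q \<or> a2 = 2 \<and> 2 * Q \<le> y + s - 1 + j"
    for b1 b2 b3 a1 a2 :: int
    using assms g that by (smt (verit))
  have "(N + s) div Q + (N - j) div Q + (s + j) div Q - (N + s + j) div Q \<le> g"
  proof (rule N_part)
    show "(N + s) div Q = 0 \<and> N + s < Q \<or> (N + s) div Q = 1 \<and> Q \<le> N + s"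
      using assms int_div_cases[OF Q, of "N + s"] by auto
    show "(N - j) div Q = -1 \<and> N < j \<or> (N - j) div Q = 0 \<and> j \<le> N"
      using assms int_div_cases[OF Q, of "N - j"] by auto
    show "(s + j) div Q = 0 \<and> s + j < Q \<or> (s + j) div Q = 1 \<and> Q \<le> s + j"
      using assms int_div_cases[OF Q, of "s + j"] by auto
    show "(N + s + j) div Q = 0 \<and> N + s + j < Q
        \<or> (N + s + j) div Q = 1 \<and> Q \<le> N + s + j \<and> N + s + j < 2 * Q
        \<or> (N + s + j) div Q = 2 \<and> 2 * Q \<le> N + s + j"
      using assms int_div_cases[OF Q, of "N + s + j"] by auto
  qed
  moreover have "(y - 1) div Q + (s - 1 + 2 * j) div Q + (y - j) div Q + g
     \<le> (y + s) div Q + (y + s - 1 + j) div Q"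
  proof (rule y_part)
    show "(y - 1) div Q = -1 \<and> y = 0 \<or> (y - 1) div Q = 0 \<and> 0 < y"
      using assms int_div_cases[OF Q, of "y - 1"] by auto
    show "(y - j) div Q = -1 \<and> y < j \<or> (y - j) div Q = 0 \<and> j \<le> y"
      using assms int_div_cases[OF Q, of "y - j"] by auto
    show "(y + s) div Q = 0 \<and> y + s < Q \<or> (y + s) div Q = 1 \<and> Q \<le> y + s"
      using assms int_div_cases[OF Q, of "y + s"] by auto
    show "(s - 1 + 2 * j) div Q = -1 \<and> s - 1 + 2 * j < 0
        \<or> (s - 1 + 2 * j) div Q = 0 \<and> 0 \<le> s - 1 + 2 * j \<and> s - 1 + 2 * j < Q
        \<or> (s - 1 + 2 * j) div Q = 1 \<and> Q \<le> s - 1 + 2 * j \<and> s - 1 + 2 * j < 2 * Q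
        \<or> (s - 1 + 2 * j) div Q = 2 \<and> 2 * Q \<le> s - 1 + 2 * j"
      by (rule int_div_cases) (use assms in linarith)+
    show "(y + s - 1 + j) div Q = -1 \<and> y + s - 1 + j < 0
        \<or> (y + s - 1 + j) div Q = 0 \<and> 0 \<le> y + s - 1 + j \<and> y + s - 1 + j < Q
        \<or> (y + s - 1 + j) div Q = 1 \<and> Q \<le> y + s - 1 + j \<and> y + s - 1 + j < 2 * Q
        \<or> (y + s - 1 + j) div Q = 2 \<and> 2 * Q \<le> y + s - 1 + j"
      by (rule int_div_cases) (use assms in linarith)+
  qed
  ultimately show ?thesis by linarith
qed

text \<open>On both sides the quotients by \<open>q\<close> contribute
  \<open>2 * y1 + 3 * s1 + 2 * N1 + 2 * j1\<close>, so they cancel and only residues matter. The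
  terms \<open>j div q\<close> and \<open>N div q\<close> leave no residue part.\<close>

lemma floor_sum_ineq:
  fixes q y s N j :: nat
  assumes "0 < q" "1 \<le> y" "1 \<le> s" "j \<le> y" "j \<le> N"
  shows "(y - 1) div q + (s - 1 + 2 * j) div q + (y - j) div q + (N + s) div q + j div q
          + (N - j) div q + (s + j) div q
         \<le> (y + s) div q + (y + s - 1 + j) div q + (N + s + j) div q + N div q"
proof -
  define y1 s1 N1 j1 where q1: "y1 = int y div q" "s1 = int s div q" "N1 = int N div q" "j1 = int j div q"
  define y0 s0 N0 j0 where q0: "y0 = int y mod q" "s0 = int s mod q" "N0 = int N mod q" "j0 = int j mod q"
  have dec: "int y = y0 + int q * y1" "int s = s0 + int q * s1" "int N = N0 + int q * N1"
    "int j = j0 + int q * j1"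
    by (auto simp: q0 q1)
  have red: "e div int q = e' div int q + c" if "e = e' + int q * c" for e e' c
    using that assms(1) by simp
  have "(int y - 1) div q = (y0 - 1) div q + y1"
    "(int s - 1 + 2 * int j) div q = (s0 - 1 + 2 * j0) div q + (s1 + 2 * j1)"
    "(int y - int j) div q = (y0 - j0) div q + (y1 - j1)"
    "(int N + int s) div q = (N0 + s0) div q + (N1 + s1)"
    "(int N - int j) div q = (N0 - j0) div q + (N1 - j1)"
    "(int s + int j) div q = (s0 + j0) div q + (s1 + j1)"
    "(int y + int s) div q = (y0 + s0) div q + (y1 + s1)"
    "(int y + int s - 1 + int j) div q = (y0 + s0 - 1 + j0) div q + (y1 + s1 + j1)"
    "(int N + int s + int j) div q = (N0 + s0 + j0) div q + (N1 + s1 + j1)"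
    by (rule red; simp add: dec algebra_simps)+
  moreover have "(y0 - 1) div q + (s0 - 1 + 2 * j0) div q + (y0 - j0) div q + (N0 + s0) div q
          + (N0 - j0) div q + (s0 + j0) div q
         \<le> (y0 + s0) div q + (y0 + s0 - 1 + j0) div q + (N0 + s0 + j0) div q"
    using assms(1) by (intro floor_sum_ineq_residues) (auto simp: q0)
  ultimately have "(int y - 1) div q + (int s - 1 + 2 * int j) div q + (int y - int j) div q
     + (int N + int s) div q + int j div q + (int N - int j) div q + (int s + int j) div q
     \<le> (int y + int s) div q + (int y + int s - 1 + int j) div q + (int N + int s + int j) div q + int N div q"
    unfolding q1(3)[symmetric] q1(4)[symmetric] by linarith
  \<comment> \<open>The hypotheses ensure that none of these natural subtractions is
    truncated.\<close>
  moreover have "int (y - 1) = int y - 1" "int (s - 1 + 2 * j) = int s - 1 + 2 * int j"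
    "int (y - j) = int y - int j" "int (N - j) = int N - int j"
    "int (y + s - 1 + j) = int y + int s - 1 + int j"
    using assms by auto
  ultimately have "int ((y - 1) div q + (s - 1 + 2 * j) div q + (y - j) div q + (N + s) div q + j div q
          + (N - j) div q + (s + j) div q)
         \<le> int ((y + s) div q + (y + s - 1 + j) div q + (N + s + j) div q + N div q)"
    by (simp only: of_nat_add zdiv_int)
  then show ?thesis by linarith
qed

lemma fact_product_dvd:
  fixes y s N j :: nat
  assumes "1 \<le> y" "1 \<le> s" "j \<le> y" "j \<le> N"
  shows "(fact (y - 1) * fact (s - 1 + 2 * j) * fact (y - j) * fact (N + s) * fact j
           * fact (N - j) * fact (s + j) :: nat)
         dvd fact (y + s) * fact (y + s - 1 + j) * fact (N + s + j) * fact N"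
proof (rule multiplicity_le_imp_dvd)
  fix p :: nat assume p: "prime p"
  \<comment> \<open>A common bound for the arguments of all the factorials.\<close>
  define M where "M = y + 2 * s + N + 2 * j"
  have mult: "multiplicity p (a * b) = multiplicity p a + multiplicity p b"
    if "0 < a" "0 < b" for a b :: nat
    using that p by (simp add: prime_elem_multiplicity_mult_distrib)
  have "0 < p" using p by (rule prime_gt_0_nat)
  then have ineq: "(y - 1) div p ^ i + (s - 1 + 2 * j) div p ^ i + (y - j) div p ^ i
      + (N + s) div p ^ i + j div p ^ i + (N - j) div p ^ i + (s + j) div p ^ i
     \<le> (y + s) div p ^ i + (y + s - 1 + j) div p ^ i + (N + s + j) div p ^ i + N div p ^ i" for i
    using assms by (intro floor_sum_ineq) simp_all
  show "multiplicity p (fact (y - 1) * fact (s - 1 + 2 * j) * fact (y - j) * fact (N + s) * fact j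
           * fact (N - j) * fact (s + j) :: nat)
         \<le> multiplicity p (fact (y + s) * fact (y + s - 1 + j) * fact (N + s + j) * fact N)"
    using assms sum_mono[of "{1..M}", OF ineq]
    by (simp add: mult multiplicity_fact[OF p, where M = M] M_def sum.distrib[symmetric])
qed simp
text \<open>For \<open>j > 0\<close> the extra 2 comes from \<open>4 ^ j\<close>. For
  \<open>j = 0\<close> the quotient of factorials is \<open>s + 1\<close> times two binomial
  coefficients, and \<open>s + 1\<close> is even.\<close>

lemma even_fact_quotient:
  fixes y s N j :: nat
  assumes "1 \<le> y" "odd s" "j \<le> y" "j \<le> N"
  shows "2 * (fact (y - 1) * fact (s - 1 + 2 * j) * fact (y - j) * fact (N + s) * fact j
           * fact (N - j) * fact (s + j) :: nat)
         dvd 4 ^ j * (fact (y + s) * fact (y + s - 1 + j) * fact (N + s + j) * fact N)"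
proof (cases "j = 0")
  case True
  have s: "1 \<le> s" using assms(2) by (cases s) auto
  have "fact (y + s) = fact (Suc s) * fact (y + s - Suc s) * ((y + s) choose Suc s)"
    using assms(1) by (intro binomial_fact_lemma[symmetric]) simp
  then have 1: "fact (y + s) = Suc s * (fact s * fact (y - 1) * ((y + s) choose Suc s))"
    by (simp add: algebra_simps del: binomial_Suc_Suc)
  have "fact (y + s - 1) = fact (s - 1) * fact (y + s - 1 - (s - 1)) * ((y + s - 1) choose (s - 1))"
    using s by (intro binomial_fact_lemma[symmetric]) simp
  then have 2: "fact (y + s - 1) = fact (s - 1) * fact y * ((y + s - 1) choose (s - 1))"
    using s by simp
  have "2 dvd Suc s" using assms(2) by simp
  then obtain c where c: "Suc s = 2 * c" ..
  have "4 ^ j * (fact (y + s) * fact (y + s - 1 + j) * fact (N + s + j) * fact N)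
     = fact (y + s) * fact (y + s - 1) * fact (N + s) * (fact N :: nat)"
    using True by simp
  also have "\<dots> = 2 * (fact (y - 1) * fact (s - 1 + 2 * j) * fact (y - j) * fact (N + s) * fact j
           * fact (N - j) * fact (s + j)) * (c * ((y + s) choose Suc s) * ((y + s - 1) choose (s - 1)))"
    unfolding 1 2 c using True by (simp del: binomial_Suc_Suc)
  finally show ?thesis by simp
next
  case False
  then have "2 dvd (4 ^ j :: nat)" by simp
  moreover have "1 \<le> s" using assms(2) by (cases s) auto
  ultimately show ?thesis
    using assms by (intro mult_dvd_mono fact_product_dvd) simp_all
qed

section \<open>The square of a three-term recurrence\<close>

text \<open>Used both with \<open>t = n\<close> and with \<open>t = x - r\<close>; in the latter case it equals
  \<open>\<Prod>i<j. (x * (x + 1) - (r + i) * (r + i + 1))\<close>.\<close>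

definition dprod :: "nat \<Rightarrow> nat \<Rightarrow> real \<Rightarrow> real" where
  "dprod r j t = (\<Prod>i<j. (t - real i) * (t + 2 * real r + 1 + real i))"

lemma dprod_0 [simp]: "dprod r 0 t = 1"
  by (simp add: dprod_def)

lemma dprod_Suc: "dprod r (Suc j) t = dprod r j t * ((t - real j) * (t + 2 * real r + 1 + real j))"
  by (simp add: dprod_def)

lemma dprod_eq_0: "n < j \<Longrightarrow> dprod r j (real n) = 0"
  by (auto simp: dprod_def)

text \<open>The products at \<open>t\<close> and \<open>t + 1\<close> differ only in their end
  factors. The cross-multiplied form stays valid where such a factor vanishes.\<close>

lemma dprod_plus_1:
  "dprod r j (t + 1) * ((t + 1 - real j) * (t + 2 * real r + 1))
    = dprod r j t * ((t + 1) * (t + 2 * real r + 1 + real j))"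
proof (induction j)
  case (Suc j)
  have "dprod r (Suc j) (t + 1) * ((t + 1 - real (Suc j)) * (t + 2 * real r + 1))
     = (dprod r j (t + 1) * ((t + 1 - real j) * (t + 2 * real r + 1))) * ((t - real j) * (t + 2 * real r + 2 + real j))"
    by (simp add: dprod_Suc algebra_simps)
  also have "\<dots> = dprod r (Suc j) t * ((t + 1) * (t + 2 * real r + 1 + real (Suc j)))"
    unfolding Suc by (simp add: dprod_Suc algebra_simps)
  finally show ?case .
qed simp

lemma dprod_Suc_plus_1:
  "(t + 2 * real r + 1) * dprod r (Suc j) (t + 1)
    = dprod r j t * ((t + 1) * (t + 2 * real r + 1 + real j) * (t + 2 * real r + 2 + real j))"
  using arg_cong[OF dprod_plus_1[of r j t], of "\<lambda>z. z * (t + 2 * real r + 2 + real j)"]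
  by (simp add: dprod_Suc algebra_simps)

lemma dprod_Suc_minus_1:
  "t * dprod r (Suc j) (t - 1)
    = dprod r j t * ((t - real j) * (t - 1 - real j) * (t + 2 * real r))"
  using arg_cong[OF dprod_plus_1[of r j "t - 1"], of "\<lambda>z. z * (t - 1 - real j)"]
  by (simp add: dprod_Suc algebra_simps)

text \<open>Both neighbours at index \<open>j + 1\<close> reduce to multiples of
  \<open>dprod r j t\<close>, which leaves a polynomial identity. The result re-expands in the
  indices \<open>j + 1\<close> and \<open>j\<close> only, as the telescoping over \<open>j\<close>
  requires.\<close>

lemma dprod_second_difference:
  "(t + 2 * real r + 1)\<^sup>2 * dprod r (Suc j) (t + 1) - t\<^sup>2 * dprod r (Suc j) (t - 1)
    = (2 * t + 2 * real r + 1) *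
      ((2 * real r + 2 * real j + 3) * dprod r (Suc j) t
        + (real j + 1) * (2 * real r + real j + 1) * (2 * real r + 2 * real j + 2) * dprod r j t)"
proof -
  have "(t + 2 * real r + 1)\<^sup>2 * dprod r (Suc j) (t + 1) - t\<^sup>2 * dprod r (Suc j) (t - 1)
    = (t + 2 * real r + 1) * ((t + 2 * real r + 1) * dprod r (Suc j) (t + 1)) - t * (t * dprod r (Suc j) (t - 1))"
    by (simp add: power2_eq_square)
  also have "\<dots> = dprod r j t * ((t + 2 * real r + 1) * ((t + 1) * (t + 2 * real r + 1 + real j) * (t + 2 * real r + 2 + real j))
     - t * ((t - real j) * (t - 1 - real j) * (t + 2 * real r)))"
    unfolding dprod_Suc_plus_1 dprod_Suc_minus_1 by (simp only: algebra_simps)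
  also have "(t + 2 * real r + 1) * ((t + 1) * (t + 2 * real r + 1 + real j) * (t + 2 * real r + 2 + real j))
     - t * ((t - real j) * (t - 1 - real j) * (t + 2 * real r))
     = (2 * t + 2 * real r + 1) *
      ((2 * real r + 2 * real j + 3) * ((t - real j) * (t + 2 * real r + 1 + real j))
        + (real j + 1) * (2 * real r + real j + 1) * (2 * real r + 2 * real j + 2))"
    by algebra
  finally show ?thesis by (simp only: dprod_Suc algebra_simps)
qed

text \<open>In rising factorials this is \<open>1 / (j! (2r+1)_j (r+1/2)_j (r+1)_j)\<close>, the
  coefficient of a 4F3 series; the power of 4 comes from splitting
  \<open>fact (2 * r + 2 * j)\<close> into even and odd factors.\<close>

definition kappa :: "nat \<Rightarrow> nat \<Rightarrow> real" where
  "kappa r j = 4 ^ j * (fact (2 * r))\<^sup>2 / (fact j * fact (2 * r + j) * fact (2 * r + 2 * j))"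

lemma kappa_0 [simp]: "kappa r 0 = 1"
  by (simp add: kappa_def power2_eq_square)

text \<open>The multiplier is the coefficient of \<open>dprod r j t\<close> in
  \<open>dprod_second_difference\<close>.\<close>

lemma kappa_Suc:
  "kappa r (Suc j) * ((real j + 1) * (2 * real r + real j + 1) * (2 * real r + 2 * real j + 2))
    = 4 * kappa r j / (2 * real r + 2 * real j + 1)"
proof -
  have "fact (2 * r + 2 * Suc j)
      = (2 * real r + 2 * real j + 2) * ((2 * real r + 2 * real j + 1) * fact (2 * r + 2 * j))"
    "fact (2 * r + Suc j) = (2 * real r + real j + 1) * fact (2 * r + j)"
    "fact (Suc j) = (real j + 1) * (fact j :: real)"
    by (simp_all add: algebra_simps)
  then show ?thesis
    unfolding kappa_def by (simp only: power_Suc) (simp add: divide_simps)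
qed

text \<open>With \<open>e n = d r n x / binomial (n + 2 * r) n\<close>, \<open>sqsum\<close> is \<open>(e n)\<^sup>2\<close>, a terminating
  \<open>4F3\<close> series of Orr and Bailey, while \<open>(2 * x + 1)\<close> times \<open>consum\<close> is
  \<open>n * e n * e (n - 1)\<close>; carrying both makes an induction with the three-term recurrence of \<open>e\<close>
  possible. The value does not depend on \<open>M > n\<close> since \<open>dprod r j n = 0\<close> for \<open>j > n\<close>.\<close>

definition sqsum :: "nat \<Rightarrow> real \<Rightarrow> nat \<Rightarrow> real \<Rightarrow> real" where
  "sqsum r x M t = (\<Sum>j<M. kappa r j * dprod r j t * dprod r j (x - real r))"

definition consum :: "nat \<Rightarrow> real \<Rightarrow> nat \<Rightarrow> real \<Rightarrow> real" where
  "consum r x M t = (\<Sum>j<M. kappa r j * dprod r j t * dprod r j (x - real r)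
      * ((t - real j) / (2 * real r + 2 * real j + 1)))"

text \<open>True summand by summand, since adding 1 to \<open>(t - j) / (2 * r + 2 * j + 1)\<close>
  gives the numerator \<open>t + 2 * r + 1 + j\<close> that \<open>dprod_plus_1\<close>
  produces.\<close>

lemma consum_plus_1:
  "(t + 2 * real r + 1) * consum r x M (t + 1) = (t + 1) * (sqsum r x M t + consum r x M t)"
proof -
  have "(t + 2 * real r + 1) * (kappa r j * dprod r j (t + 1) * dprod r j (x - real r)
      * ((t + 1 - real j) / (2 * real r + 2 * real j + 1)))
    = (t + 1) * (kappa r j * dprod r j t * dprod r j (x - real r)
     + kappa r j * dprod r j t * dprod r j (x - real r) * ((t - real j) / (2 * real r + 2 * real j + 1)))"
    (is "?l = ?r") for j
  proof -
    have "?l = kappa r j * dprod r j (x - real r) / (2 * real r + 2 * real j + 1)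
       * (dprod r j (t + 1) * ((t + 1 - real j) * (t + 2 * real r + 1)))"
      by (simp add: mult_ac)
    also have "\<dots> = kappa r j * dprod r j (x - real r) * dprod r j t * (t + 1) *
      ((t + 2 * real r + 1 + real j) / (2 * real r + 2 * real j + 1))"
      unfolding dprod_plus_1 by simp
    also have "(t + 2 * real r + 1 + real j) / (2 * real r + 2 * real j + 1)
       = 1 + (t - real j) / (2 * real r + 2 * real j + 1)"
      by (simp add: divide_simps)
    finally show ?thesis by (simp only: algebra_simps)
  qed
  then show ?thesis
    unfolding sqsum_def consum_def by (simp only: sum_distrib_left sum.distrib[symmetric])
qed

text \<open>Writing \<open>(2 * x + 1)\<^sup>2\<close> as \<open>4 * (x - r - j) * (x + r + 1 + j) + (2 * r + 2 * j + 1)\<^sup>2\<close> shifts part of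
  the \<open>j\<close>-th summand to index \<open>j + 1\<close>, so truncation at \<open>M\<close> leaves one boundary term.\<close>

lemma sqsum_plus_1_telescope:
  "(t + 2 * real r + 1)\<^sup>2 * sqsum r x (Suc M) (t + 1)
    = (2 * x + 1)\<^sup>2 * (sqsum r x (Suc M) t + 2 * consum r x (Suc M) t) + t\<^sup>2 * sqsum r x (Suc M) (t - 1)
      - 4 * kappa r M * dprod r M t * dprod r (Suc M) (x - real r)
        * ((2 * t + 2 * real r + 1) / (2 * real r + 2 * real M + 1))"
proof (induction M)
  case 0
  show ?case by (simp add: sqsum_def consum_def dprod_Suc power2_eq_square divide_simps) algebra
next
  case (Suc M)
  define c where "c = kappa r (Suc M)"
  define k where "k = 4 * kappa r M / (2 * real r + 2 * real M + 1)"
  define q where "q = 2 * t + 2 * real r + 1"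
  define e where "e = 2 * real r + 2 * real M + 3"
  define X where "X = dprod r (Suc M) (x - real r)"
  define A where "A = dprod r (Suc M) t"
  define B where "B = (real M + 1) * (2 * real r + real M + 1) * (2 * real r + 2 * real M + 2)"
  have e: "e \<noteq> 0" by (simp add: e_def)
  have k: "c * B = k" unfolding c_def B_def k_def by (rule kappa_Suc)
  have lin: "t - real (Suc M) = (q - e) / 2" by (simp add: q_def e_def)
  have den: "2 * real r + 2 * real (Suc M) + 1 = e" by (simp add: e_def)
  have x2: "(2 * x + 1)\<^sup>2 = 4 * ((x - real r - real (Suc M)) * (x - real r + 2 * real r + 1 + real (Suc M))) + e\<^sup>2"
    by (simp add: e_def power2_eq_square algebra_simps)
  have "(t + 2 * real r + 1)\<^sup>2 * dprod r (Suc M) (t + 1) - t\<^sup>2 * dprod r (Suc M) (t - 1)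
     = q * (e * A + B * dprod r M t)"
    unfolding dprod_second_difference q_def e_def A_def B_def by simp
  then have diff: "(t + 2 * real r + 1)\<^sup>2 * (c * dprod r (Suc M) (t + 1) * X)
     = t\<^sup>2 * (c * dprod r (Suc M) (t - 1) * X) + q * (e * c * A + k * dprod r M t) * X"
    unfolding k[symmetric] by algebra
  have new: "(2 * x + 1)\<^sup>2 * (c * A * X + 2 * (c * A * X * ((t - real (Suc M)) / e)))
     = 4 * c * A * dprod r (Suc (Suc M)) (x - real r) * (q / e) + q * e * c * A * X"
  proof -
    have "c * A * X + 2 * (c * A * X * ((t - real (Suc M)) / e)) = c * A * X * (q / e)"
      unfolding lin using e by (simp add: field_simps)
    then show ?thesis
      unfolding x2 dprod_Suc[of r "Suc M"] X_def[symmetric] using e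
      by (simp add: field_simps power2_eq_square)
  qed
  \<comment> \<open>The old boundary term cancels the part of \<open>diff\<close> at index
    \<open>M\<close>; the rest of \<open>diff\<close> matches \<open>new\<close> up to the new
    boundary term.\<close>
  have old: "4 * kappa r M * dprod r M t * X * (q / (2 * real r + 2 * real M + 1)) = q * k * dprod r M t * X"
    by (simp add: k_def)
  have S: "sqsum r x (Suc (Suc M)) t' = sqsum r x (Suc M) t' + c * dprod r (Suc M) t' * X" for t'
    by (simp add: sqsum_def c_def X_def)
  have C: "consum r x (Suc (Suc M)) t = consum r x (Suc M) t + c * A * X * ((t - real (Suc M)) / e)"
    unfolding den[symmetric] by (simp add: consum_def c_def X_def A_def)
  show ?case
    unfolding S C den using Suc new old diff
    unfolding X_def[symmetric] A_def[symmetric] c_def[symmetric] q_def[symmetric] distrib_left[of _ _ "_::real"]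
    by (simp only: algebra_simps) 
qed

lemma sqsum_plus_1:
  assumes "n + 2 < M"
  shows "(real n + 2 * real r + 2)\<^sup>2 * sqsum r x M (real n + 2)
    = (2 * x + 1)\<^sup>2 * (sqsum r x M (real n + 1) + 2 * consum r x M (real n + 1))
      + (real n + 1)\<^sup>2 * sqsum r x M (real n)"
proof -
  obtain M' where M: "M = Suc M'" "Suc n < M'" using assms by (cases M) auto
  then have "dprod r M' (real n + 1) = 0"
    using dprod_eq_0[of "Suc n" M' r] by (simp add: add.commute)
  then show ?thesis
    using sqsum_plus_1_telescope[of "real n + 1" r x M'] unfolding M(1) by (simp add: add.commute add.left_commute)
qed

text \<open>Squaring the recurrence brings in the product of neighbours; multiplying it by
  \<open>e (n + 1)\<close> expresses the next such product by a square and the previous product.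
  This closed system is the one satisfied by \<open>sqsum\<close> and \<open>consum\<close>.\<close>

lemma square_formula:
  fixes e :: "nat \<Rightarrow> real"
  assumes e0: "e 0 = 1"
    and e1: "(2 * real r + 1) * e 1 = 2 * x + 1"
    and rec: "\<And>n. (real n + 2 * real r + 2) * e (n + 2) = (2 * x + 1) * e (n + 1) + (real n + 1) * e n"
    and M: "n + 1 < M"
  shows "(e n)\<^sup>2 = sqsum r x M (real n) \<and> (e (n + 1))\<^sup>2 = sqsum r x M (real n + 1)
    \<and> (real n + 1) * (e (n + 1) * e n) = (2 * x + 1) * consum r x M (real n + 1)"
  using M
proof (induction n)
  case 0
  have 1: "dprod r j 0 = (if j = 0 then 1 else 0)" for j
    using dprod_eq_0[of 0 j r] by simp
  obtain M' where M': "M = Suc M'" "0 < M'" using 0 by (cases M) auto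
  have "sqsum r x (Suc k) 0 = 1 \<and> consum r x (Suc k) 0 = 0" for k
    by (induction k) (simp_all add: sqsum_def consum_def 1)
  then have 2: "sqsum r x M 0 = 1" "consum r x M 0 = 0"
    by (simp_all add: M')
  \<comment> \<open>At \<open>t = 0\<close> the factor \<open>t\<^sup>2\<close> removes the value at
    \<open>t - 1\<close>, and the boundary term vanishes because \<open>M' > 0\<close>.\<close>
  have 3: "(2 * real r + 1)\<^sup>2 * sqsum r x M 1 = (2 * x + 1)\<^sup>2"
    using sqsum_plus_1_telescope[of 0 r x M'] 2 1[of M'] M' by simp
  have 4: "(2 * real r + 1) * consum r x M 1 = 1"
    using consum_plus_1[of 0 r x M] 2 by simp
  have r: "2 * real r + 1 \<noteq> 0" by linarith
  have "e 1 = (2 * x + 1) / (2 * real r + 1)" using e1 r by (simp add: field_simps)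
  moreover have "sqsum r x M 1 = (2 * x + 1)\<^sup>2 / (2 * real r + 1)\<^sup>2"
    using 3 r by (simp add: field_simps)
  moreover have "consum r x M 1 = 1 / (2 * real r + 1)"
    using 4 r by (simp add: field_simps)
  ultimately show ?case using e0 2 by (simp add: power_divide)
next
  case (Suc n)
  then have IH: "(e n)\<^sup>2 = sqsum r x M (real n)" "(e (n + 1))\<^sup>2 = sqsum r x M (real n + 1)"
    "(real n + 1) * (e (n + 1) * e n) = (2 * x + 1) * consum r x M (real n + 1)"
    by simp_all
  have nz: "real n + 2 * real r + 2 \<noteq> 0" by linarith
  have "((real n + 2 * real r + 2) * e (n + 2))\<^sup>2
     = (2 * x + 1)\<^sup>2 * (e (n + 1))\<^sup>2 + 2 * (2 * x + 1) * ((real n + 1) * (e (n + 1) * e n)) + (real n + 1)\<^sup>2 * (e n)\<^sup>2"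
    unfolding rec by algebra
  also have "\<dots> = (real n + 2 * real r + 2)\<^sup>2 * sqsum r x M (real n + 2)"
    unfolding IH using sqsum_plus_1[of n M r x] Suc.prems
    by (simp add: power2_eq_square algebra_simps)
  finally have sq: "(e (n + 2))\<^sup>2 = sqsum r x M (real n + 2)"
    using nz by (simp add: power_mult_distrib)
  have "(real n + 2 * real r + 2) * ((real n + 2) * (e (n + 2) * e (n + 1)))
     = (real n + 2) * ((2 * x + 1) * (e (n + 1))\<^sup>2 + (real n + 1) * (e (n + 1) * e n))"
    using rec[of n] by algebra
  also have "\<dots> = (2 * x + 1) * ((real n + 2) * (sqsum r x M (real n + 1) + consum r x M (real n + 1)))"
    unfolding IH by (simp add: algebra_simps)
  also have "\<dots> = (real n + 2 * real r + 2) * ((2 * x + 1) * consum r x M (real n + 2))"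
    using consum_plus_1[of "real n + 1" r x M] by (simp add: algebra_simps)
  finally have "(real n + 2) * (e (n + 2) * e (n + 1)) = (2 * x + 1) * consum r x M (real n + 2)"
    using nz by simp
  then show ?case using sq IH(2) by (simp add: add.commute add.left_commute)
qed

section \<open>The recurrence of \<open>d\<close> and the congruence\<close>

lemma d_0: "d r 0 x = 1"
  by (simp add: d_def)

text \<open>The generating function \<open>(1 + t) powr (x - r) / (1 - t) powr (x + r + 1)\<close> of the \<open>d r n x\<close>
  satisfies a first-order linear differential equation.\<close>

lemma d_recurrence:
  shows "d r 1 x = 2 * x + 1"
    and "(of_nat n + 2) * d r (n + 2) x
      = (2 * x + 1) * d r (n + 1) x + (of_nat n + 2 * r + 1) * d r n x"
proof -
  define f where "f = Abs_fps (\<lambda>k. (x + r + of_nat k) gchoose k)"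
  define g where "g = Abs_fps (\<lambda>k. (x - r) gchoose k)"
  define G where "G = f * g"
  have G: "fps_nth G m = d r m x" for m
    by (simp add: G_def f_def g_def d_def fps_mult_nth)
  have f': "fps_deriv f - fps_X * fps_deriv f = fps_const (x + r + 1) * f"
  proof (rule fps_ext)
    fix m
    have "of_nat (Suc m) * ((x + r + of_nat m + 1) gchoose Suc m) = (x + r + of_nat m + 1) * ((x + r + of_nat m) gchoose m)"
      by (rule Suc_times_gbinomial)
    then show "fps_nth (fps_deriv f - fps_X * fps_deriv f) m = fps_nth (fps_const (x + r + 1) * f) m"
      by (cases m) (simp_all add: f_def algebra_simps)
  qed
  have g': "fps_deriv g + fps_X * fps_deriv g = fps_const (x - r) * g"
  proof (rule fps_ext)
    fix m
    show "fps_nth (fps_deriv g + fps_X * fps_deriv g) m = fps_nth (fps_const (x - r) * g) m"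
      using gbinomial_mult_1[of "x - r" m]
      by (cases m) (simp_all add: g_def algebra_simps)
  qed
  have "fps_deriv G - fps_X * (fps_X * fps_deriv G)
     = (1 + fps_X) * g * (fps_deriv f - fps_X * fps_deriv f) + (1 - fps_X) * f * (fps_deriv g + fps_X * fps_deriv g)"
    by (simp add: G_def algebra_simps)
  also have "\<dots> = (fps_const (x + r + 1) + fps_const (x - r)) * G
     + (fps_const (x + r + 1) - fps_const (x - r)) * (fps_X * G)"
    unfolding f' g' by (simp only: G_def ring_distribs mult_ac) (simp add: algebra_simps)
  also have "fps_const (x + r + 1) + fps_const (x - r) = fps_const (2 * x + 1)"
    by (simp add: algebra_simps)
  also have "fps_const (x + r + 1) - fps_const (x - r) = fps_const (2 * r + 1)"
    by (simp add: algebra_simps)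
  finally have ode: "fps_deriv G - fps_X * (fps_X * fps_deriv G)
     = fps_const (2 * x + 1) * G + fps_const (2 * r + 1) * (fps_X * G)" .
  show "d r 1 x = 2 * x + 1"
    using arg_cong[OF ode, of "\<lambda>h. fps_nth h 0"] by (simp add: G d_0)
  show "(of_nat n + 2) * d r (n + 2) x
      = (2 * x + 1) * d r (n + 1) x + (of_nat n + 2 * r + 1) * d r n x"
    using arg_cong[OF ode, of "\<lambda>h. fps_nth h (Suc n)"] by (cases n) (simp_all add: G algebra_simps)
qed

lemma d_int_recurrence:
  shows "d_int r 0 x = 1"
    and "d_int r 1 x = 2 * x + 1"
    and "(int n + 2) * d_int r (n + 2) x = (2 * x + 1) * d_int r (n + 1) x + (int n + 2 * r + 1) * d_int r n x"
proof -
  have "of_int (d_int r 0 x) = (of_int 1 :: complex)"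
    by (simp add: of_int_d_int d_0)
  then show "d_int r 0 x = 1" by (simp only: of_int_eq_iff)
  have "of_int (d_int r 1 x) = (of_int (2 * x + 1) :: complex)"
    unfolding of_int_d_int d_recurrence(1) by simp
  then show "d_int r 1 x = 2 * x + 1" by (simp only: of_int_eq_iff)
  have "of_int ((int n + 2) * d_int r (n + 2) x)
      = (of_int ((2 * x + 1) * d_int r (n + 1) x + (int n + 2 * r + 1) * d_int r n x) :: complex)"
    using d_recurrence(2)[of n "of_int r" "of_int x"] by (simp add: of_int_d_int)
  then show "(int n + 2) * d_int r (n + 2) x = (2 * x + 1) * d_int r (n + 1) x + (int n + 2 * r + 1) * d_int r n x"
    by (simp only: of_int_eq_iff)
qed

text \<open>Under the reflection \<open>2 * x + 1\<close> changes sign and the other coefficients of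
  the recurrence stay fixed. As it has order two, the induction carries two consecutive
  values.\<close>

lemma d_int_reflect: "d_int r n (- 1 - x) = (- 1) ^ n * d_int r n x"
proof -
  have "d_int r n (- 1 - x) = (- 1) ^ n * d_int r n x
    \<and> d_int r (n + 1) (- 1 - x) = (- 1) ^ (n + 1) * d_int r (n + 1) x"
  proof (induction n)
    case 0
    show ?case using d_int_recurrence(1,2)[of r] by simp
  next
    case (Suc n)
    have "(int n + 2) * d_int r (n + 2) (- 1 - x) = (int n + 2) * ((- 1) ^ (n + 2) * d_int r (n + 2) x)"
      using Suc d_int_recurrence(3)[of n r x] d_int_recurrence(3)[of n r "- 1 - x"]
      by (simp add: algebra_simps)
    then have "d_int r (n + 2) (- 1 - x) = (- 1) ^ (n + 2) * d_int r (n + 2) x"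
      by simp
    then show ?case using Suc by simp
  qed
  then show ?thesis ..
qed

section \<open>The square of \<open>d\<close> and its weighted sum over \<open>k\<close>\<close>

lemma Suc_times_binomial_shift:
  "real (Suc n) * real (Suc n + 2 * r choose Suc n) = (real n + 2 * real r + 1) * real (n + 2 * r choose n)"
  using arg_cong[OF Suc_times_binomial_eq[of "n + 2 * r" n], of real] by (simp add: algebra_simps)

text \<open>Dividing by \<open>P n\<close> normalises the recurrence: both
  \<open>(m + 2) * P (m + 2)\<close> and \<open>(m + 2 * r + 1) * P m\<close> are multiples of
  \<open>P (m + 1)\<close>, which then cancels.\<close>

lemma d_int_square:
  assumes "n + 1 < M"
  shows "(real_of_int (d_int (int r) n x))\<^sup>2
    = (real (n + 2 * r choose n))\<^sup>2 * sqsum r (real_of_int x) M (real n)"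
proof -
  define P where "P n = real (n + 2 * r choose n)" for n
  define e where "e n = real_of_int (d_int (int r) n x) / P n" for n
  have P_pos: "P n > 0" for n by (simp add: P_def)
  have P_Suc: "(real n + 1) * P (n + 1) = (real n + 2 * real r + 1) * P n" for n
    using Suc_times_binomial_shift[of n r] by (simp add: P_def algebra_simps)
  have de: "real_of_int (d_int (int r) n x) = P n * e n" for n
    using P_pos[of n] by (simp add: e_def)
  have "(e n)\<^sup>2 = sqsum r x M (real n) \<and> (e (n + 1))\<^sup>2 = sqsum r x M (real n + 1)
    \<and> (real n + 1) * (e (n + 1) * e n) = (2 * real_of_int x + 1) * consum r x M (real n + 1)"
  proof (rule square_formula[OF _ _ _ assms])
    show "e 0 = 1" by (simp add: e_def P_def d_int_recurrence(1))
    show "(2 * real r + 1) * e 1 = 2 * real_of_int x + 1"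
    proof -
      have "P 1 = 2 * real r + 1" using P_Suc[of 0] by (simp add: P_def)
      moreover have "2 * real r + 1 \<noteq> 0" by linarith
      ultimately show ?thesis unfolding e_def d_int_recurrence(2) by simp
    qed
    fix m
    have "real_of_int ((int m + 2) * d_int (int r) (m + 2) x)
       = real_of_int ((2 * x + 1) * d_int (int r) (m + 1) x + (int m + 2 * int r + 1) * d_int (int r) m x)"
      by (simp only: d_int_recurrence(3))
    then have "(real m + 2) * P (m + 2) * e (m + 2)
       = (2 * real_of_int x + 1) * (P (m + 1) * e (m + 1)) + (real m + 2 * real r + 1) * P m * e m"
      by (simp add: de mult.assoc)
    moreover have "(real m + 2) * P (m + 2) = (real m + 2 * real r + 2) * P (m + 1)"
      using P_Suc[of "m + 1"] by (simp add: algebra_simps)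
    ultimately have "P (m + 1) * ((real m + 2 * real r + 2) * e (m + 2))
      = P (m + 1) * ((2 * real_of_int x + 1) * e (m + 1) + (real m + 1) * e m)"
      using P_Suc[of m] by algebra
    then show "(real m + 2 * real r + 2) * e (m + 2) = (2 * real_of_int x + 1) * e (m + 1) + (real m + 1) * e m"
      using P_pos[of "m + 1"] by simp
  qed
  then show ?thesis unfolding de by (simp add: power_mult_distrib P_def)
qed

text \<open>The closed form telescopes because \<open>(n + 2r + 1)(n + 2r + 1 + j) - n(n - j) = (2n
  + 2r + 1)(2r + 1 + j)\<close>.\<close>

lemma sum_binomial_dprod:
  "(\<Sum>k<n. (2 * real k + 2 * real r + 1) * (real (k + 2 * r choose k))\<^sup>2 * dprod r j (real k))
    = (real (n + 2 * r choose n))\<^sup>2 * real n * (real n - real j) * dprod r j (real n)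
       / (2 * real r + 1 + real j)"
proof (induction n)
  case (Suc n)
  define p where "p = real (n + 2 * r choose n)"
  define p' where "p' = real (Suc n + 2 * r choose Suc n)"
  have c: "2 * real r + 1 + real j \<noteq> 0" by linarith
  have p': "(real n + 1) * p' = (real n + 2 * real r + 1) * p"
    using Suc_times_binomial_shift[of n r] by (simp add: p_def p'_def algebra_simps)
  have "(real n + 1) * (p'\<^sup>2 * (real n + 1) * (real n + 1 - real j) * dprod r j (real n + 1))
     = ((real n + 1) * p')\<^sup>2 * ((real n + 1 - real j) * dprod r j (real n + 1))"
    by algebra
  also have "\<dots> = (real n + 2 * real r + 1) * p\<^sup>2 * (dprod r j (real n + 1) * ((real n + 1 - real j) * (real n + 2 * real r + 1)))"
    unfolding p' by algebra
  also have "\<dots> = (real n + 1) * ((real n + 2 * real r + 1) * p\<^sup>2 * dprod r j (real n) * (real n + 2 * real r + 1 + real j))"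
    unfolding dprod_plus_1 by algebra
  finally have "p'\<^sup>2 * (real n + 1) * (real n + 1 - real j) * dprod r j (real n + 1)
     = (real n + 2 * real r + 1) * p\<^sup>2 * dprod r j (real n) * (real n + 2 * real r + 1 + real j)"
    by (simp add: mult_cancel_left)
  also have "\<dots> = p\<^sup>2 * real n * (real n - real j) * dprod r j (real n)
      + (2 * real n + 2 * real r + 1) * p\<^sup>2 * dprod r j (real n) * (2 * real r + 1 + real j)"
    by algebra
  finally have "p'\<^sup>2 * real (Suc n) * (real (Suc n) - real j) * dprod r j (real (Suc n)) / (2 * real r + 1 + real j)
     = p\<^sup>2 * real n * (real n - real j) * dprod r j (real n) / (2 * real r + 1 + real j)
      + (2 * real n + 2 * real r + 1) * p\<^sup>2 * dprod r j (real n)"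
    using c by (simp add: add_divide_distrib add.commute)
  then show ?case unfolding sum.lessThan_Suc Suc p_def p'_def by simp
qed simp

text \<open>The cutoff \<open>n + 2\<close> serves every \<open>k < n\<close> at once, so the two
  sums can be interchanged.\<close>

lemma sum_d_int_square:
  "(\<Sum>k<n. (2 * real k + 2 * real r + 1) * (real_of_int (d_int (int r) k x))\<^sup>2)
    = (\<Sum>j<n+2. kappa r j * dprod r j (real_of_int x - real r)
        * ((real (n + 2 * r choose n))\<^sup>2 * real n * (real n - real j) * dprod r j (real n)
       / (2 * real r + 1 + real j)))"
proof -
  have "(\<Sum>k<n. (2 * real k + 2 * real r + 1) * (real_of_int (d_int (int r) k x))\<^sup>2)
    = (\<Sum>k<n. \<Sum>j<n+2. kappa r j * dprod r j (real_of_int x - real r)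
        * ((2 * real k + 2 * real r + 1) * (real (k + 2 * r choose k))\<^sup>2 * dprod r j (real k)))"
  proof (rule sum.cong[OF refl])
    fix k assume "k \<in> {..<n}"
    then have "k + 1 < n + 2" by simp
    then show "(2 * real k + 2 * real r + 1) * (real_of_int (d_int (int r) k x))\<^sup>2
      = (\<Sum>j<n+2. kappa r j * dprod r j (real_of_int x - real r)
        * ((2 * real k + 2 * real r + 1) * (real (k + 2 * r choose k))\<^sup>2 * dprod r j (real k)))"
      unfolding d_int_square[OF \<open>k + 1 < n + 2\<close>] sqsum_def sum_distrib_left
      by (intro sum.cong refl) (simp only: mult_ac)
  qed
  also have "\<dots> = (\<Sum>j<n+2. \<Sum>k<n. kappa r j * dprod r j (real_of_int x - real r)
        * ((2 * real k + 2 * real r + 1) * (real (k + 2 * r choose k))\<^sup>2 * dprod r j (real k)))"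
    by (rule sum.swap)
  also have "\<dots> = (\<Sum>j<n+2. kappa r j * dprod r j (real_of_int x - real r)
        * ((real (n + 2 * r choose n))\<^sup>2 * real n * (real n - real j) * dprod r j (real n)
       / (2 * real r + 1 + real j)))"
    by (simp only: sum_distrib_left[symmetric] sum_binomial_dprod)
  finally show ?thesis .
qed

section \<open>Factorial forms and integrality of the summands\<close>

lemma dprod_fact:
  assumes "j \<le> t"
  shows "dprod r j (real t) = fact t / fact (t - j) * (fact (t + 2 * r + j) / fact (t + 2 * r))"
  using assms
proof (induction j)
  case (Suc j)
  have "t - j = Suc (t - Suc j)" using Suc.prems by simp
  then have 1: "fact (t - j) = (real t - real j) * fact (t - Suc j)"
    using Suc.prems by (simp add: of_nat_diff)
  have 2: "fact (t + 2 * r + Suc j) = (real t + 2 * real r + 1 + real j) * fact (t + 2 * r + j)"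
    by simp
  have 3: "dprod r j (real t) = fact t / fact (t - j) * (fact (t + 2 * r + j) / fact (t + 2 * r))"
    using Suc by simp
  have "real t - real j \<noteq> 0" using Suc.prems by simp
  then show ?case unfolding dprod_Suc 2 3 1 by simp
qed simp

lemma prod_fact: "(\<Prod>i=0..k. real (Suc m) + real i) = fact (m + k + 1) / fact m"
proof (induction k)
  case (Suc k)
  have "fact (m + Suc k + 1) = (real (Suc m) + real (Suc k)) * fact (m + k + 1)"
    by (simp add: algebra_simps)
  then show ?case unfolding prod.atLeast0_atMost_Suc Suc by simp
qed simp

lemma prod_consecutive_fact:
  assumes "1 \<le> t"
  shows "(\<Prod>i=0..2*r. real t + real i) = fact (t + 2 * r) / fact (t - 1)"
  using prod_fact[of "t - 1" "2 * r"] assms by simp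

lemma prod_symmetric_range:
  fixes x :: int
  assumes "1 \<le> y" "x = int r + int y"
  shows "real_of_int (\<Prod>k=-int r..int r. (x + k) * (x + 1 - k))
    = fact (y + 2 * r) / fact (y - 1) * (fact (y + 2 * r + 1) / fact y)"
proof -
  have "(\<Prod>k=-int r..int r. real_of_int (x + k)) = (\<Prod>i=0..2*r. real y + real i)"
    by (rule prod.reindex_bij_witness[where i = "\<lambda>i. int i - int r" and j = "\<lambda>k. nat (k + int r)"])
       (use assms in auto)
  moreover have "(\<Prod>k=-int r..int r. real_of_int (x + 1 - k)) = (\<Prod>i=0..2*r. real (y + 1) + real i)"
    by (rule prod.reindex_bij_witness[where i = "\<lambda>i. int r - int i" and j = "\<lambda>k. nat (int r - k)"])
       (use assms in auto)
  ultimately show ?thesis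
    using prod_consecutive_fact[of y r] prod_consecutive_fact[of "y + 1" r] assms(1)
    by (simp add: prod.distrib)
qed

lemma summand_integrality:
  fixes n r y j :: nat
  assumes n: "1 \<le> n" and y: "1 \<le> y"
  defines "R \<equiv> fact (y + 2 * r) / fact (y - 1) * (fact (y + 2 * r + 1) / fact y) :: real"
    and "A \<equiv> fact (n + 2 * r) / fact (n - 1) :: real"
  shows "(2 * real r + 1) * R * (kappa r j * dprod r j (real y)
        * ((real (n + 2 * r choose n))\<^sup>2 * real n * (real n - real j) * dprod r j (real n)
           / (2 * real r + 1 + real j))) / (2 * A\<^sup>2) \<in> \<int>" (is "?T \<in> \<int>")
proof (cases "j \<le> y \<and> j < n")
  case False
  \<comment> \<open>\<open>dprod\<close> vanishes in the first and last cases, the factor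
    \<open>n - j\<close> in the middle one.\<close>
  then consider "y < j" | "n = j" | "n < j" by linarith
  then have "?T = 0" by cases (simp_all add: dprod_eq_0)
  then show ?thesis by (simp only: Ints_0)
next
  case True
  define s where "s = 2 * r + 1"
  \<comment> \<open>The factor \<open>n - j\<close> shortens \<open>fact (n - j)\<close> to
    \<open>fact (m - j)\<close>, so the factorial quotient is used with
    \<open>N = m\<close>.\<close>
  define m where "m = n - 1"
  have nm: "n = m + 1" "j \<le> m" using n True by (auto simp: m_def)
  define den num :: nat
    where "den = fact (y - 1) * fact (s - 1 + 2 * j) * fact (y - j) * fact (m + s) * fact j
             * fact (m - j) * fact (s + j)"
      and "num = fact (y + s) * fact (y + s - 1 + j) * fact (m + s + j) * fact m"
  have "2 * den dvd 4 ^ j * num"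
    unfolding den_def num_def using y True nm by (intro even_fact_quotient) (simp_all add: s_def)
  then obtain c where c: "4 ^ j * num = 2 * den * c" ..
  have A: "A = fact (m + s) / fact m" by (simp add: A_def nm s_def add_ac)
  have binom: "real (n + 2 * r choose n) * real n = A / fact (2 * r)"
  proof -
    have "real (n + 2 * r choose n) = fact (n + 2 * r) / (fact n * fact (2 * r))"
      using binomial_fact[of n "n + 2 * r", where 'a = real] by simp
    moreover have "fact n = real n * fact m" by (simp add: nm)
    ultimately show ?thesis using n by (simp add: A_def m_def)
  qed
  have dn: "(real n - real j) * dprod r j (real n)
     = real n * (fact m / fact (m - j) * (fact (m + s + j) / fact (m + s)))"
  proof -
    have "n + 2 * r + j = m + s + j" "n + 2 * r = m + s"
      using nm by (simp_all add: s_def)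
    then have 1: "dprod r j (real n) = fact n / fact (n - j) * (fact (m + s + j) / fact (m + s))"
      using dprod_fact[of j n r] True by simp
    have 2: "fact n = real n * fact m" "fact (n - j) = (real n - real j) * fact (m - j)"
      using nm by (simp_all add: Suc_diff_le of_nat_diff)
    show ?thesis unfolding 1 2 using True by simp
  qed
  \<comment> \<open>The divisor \<open>2 * r + 1 + j\<close> merges with
    \<open>fact (2 * r + j)\<close> from \<open>kappa\<close>.\<close>
  have sj: "fact (s + j) = (2 * real r + 1 + real j) * fact (2 * r + j)" "s - 1 + 2 * j = 2 * r + 2 * j"
    by (simp_all add: s_def)
  have "(real (n + 2 * r choose n))\<^sup>2 * real n * (real n - real j) * dprod r j (real n)
     = (real (n + 2 * r choose n) * real n)\<^sup>2 * (fact m / fact (m - j) * (fact (m + s + j) / fact (m + s)))"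
    by (simp only: mult.assoc dn) (simp add: power2_eq_square mult_ac)
  then have "?T = (2 * real r + 1) * R * (kappa r j * dprod r j (real y)
        * (A\<^sup>2 / (fact (2 * r))\<^sup>2 * (fact m / fact (m - j) * (fact (m + s + j) / fact (m + s)))
           / (2 * real r + 1 + real j))) / (2 * A\<^sup>2)"
    unfolding binom by (simp only: power_divide)
  also have "\<dots> = (2 * real r + 1) * (4 ^ j * real num / (2 * real den))"
  proof -
    define S C where "S = 2 * real r + 1" and "C = 2 * real r + 1 + real j"
    have nz: "A \<noteq> 0" "C \<noteq> 0" unfolding C_def by (simp add: A_def, linarith)
    have "dprod r j (real y) = fact y / fact (y - j) * (fact (y + 2 * r + j) / fact (y + 2 * r))"
      using True by (simp add: dprod_fact)
    moreover have "y + s - 1 + j = y + 2 * r + j" "y + s = y + 2 * r + 1" by (simp_all add: s_def)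
    ultimately show ?thesis
      using nz unfolding den_def num_def kappa_def R_def of_nat_mult of_nat_fact sj
      unfolding C_def[symmetric]
      unfolding S_def[symmetric]
      by (simp add: field_simps del: fact_Suc)
  qed
  also have "4 ^ j * real num / (2 * real den) = real c"
    using arg_cong[OF c, of real] by (simp add: den_def field_simps)
  finally show ?thesis by (metis Ints_of_nat Ints_mult Ints_add Ints_1 Ints_numeral)
qed

text \<open>For \<open>x > r\<close> the shift \<open>y = x - r\<close> is a positive natural
  number, so every product becomes a quotient of factorials.\<close>

lemma congruence_beyond_r:
  fixes n r :: nat and x :: int
  assumes n: "1 \<le> n" and x: "int r < x"
  shows "2 * (\<Prod>i=0..2*r. (int n + int i)\<^sup>2) dvd
     (2 * int r + 1) * (\<Prod>k=-int r..int r. (x + k) * (x + 1 - k))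
            * (\<Sum>k=0..n-1. (2 * int k + 2 * int r + 1) * (d_int (int r) k x)\<^sup>2)" (is "?M dvd ?L")
proof -
  define y where "y = nat (x - int r)"
  have y: "1 \<le> y" "x = int r + int y" using x by (auto simp: y_def)
  define R A :: real
    where "R = fact (y + 2 * r) / fact (y - 1) * (fact (y + 2 * r + 1) / fact y)"
      and "A = fact (n + 2 * r) / fact (n - 1)"
  have M: "real_of_int ?M = 2 * A\<^sup>2"
    using prod_consecutive_fact[OF n, of r] by (simp add: A_def prod_power_distrib[symmetric])
  have xy: "real_of_int x - real r = real y" by (simp add: y(2))
  have range: "{0..n-1} = {..<n}" using n by auto
  have "real_of_int ?L = (2 * real r + 1) * R
     * (\<Sum>k<n. (2 * real k + 2 * real r + 1) * (real_of_int (d_int (int r) k x))\<^sup>2)"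
    unfolding of_int_mult prod_symmetric_range[OF y] range R_def by simp
  then have "real_of_int ?L / (2 * A\<^sup>2) = (\<Sum>j<n+2. (2 * real r + 1) * R * (kappa r j * dprod r j (real y)
        * ((real (n + 2 * r choose n))\<^sup>2 * real n * (real n - real j) * dprod r j (real n)
           / (2 * real r + 1 + real j))) / (2 * A\<^sup>2))"
    unfolding sum_d_int_square xy by (simp only: sum_distrib_left sum_divide_distrib)
  also have "\<dots> \<in> \<int>"
    unfolding R_def A_def by (intro Ints_sum summand_integrality n y(1))
  finally obtain z where z: "real_of_int ?L / (2 * A\<^sup>2) = of_int z" by (auto elim: Ints_cases)
  have "A \<noteq> 0" by (simp add: A_def)
  then have "real_of_int ?L = real_of_int (?M * z)"
    using z M by (simp only: of_int_mult) (simp add: field_simps)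
  then show ?thesis by (simp only: of_int_eq_iff dvd_triv_left)
qed

theorem theorem2p5:
  fixes n r :: nat and x :: int
  assumes "n \<ge> 1"
  shows "[(2 * int r + 1) * (\<Prod>k=-int r..int r. (x + k) * (x + 1 - k))
            * (\<Sum>k=0..n-1. (2 * int k + 2 * int r + 1) * (d_int (int r) k x)\<^sup>2) = 0]
         (mod (2 * (\<Prod>i=0..2*r. (int n + int i)\<^sup>2)))"
proof -
  consider "int r < x" | "int r < - 1 - x" | "- int r - 1 \<le> x" "x \<le> int r" by linarith
  then show ?thesis
  proof cases
    case 1
    then show ?thesis using congruence_beyond_r[OF assms] by (simp only: cong_0_iff)
  next
    case 2
    \<comment> \<open>The reflection swaps the two factors up to sign, and the signs cancel.\<close>
    have "(\<Prod>k=-int r..int r. (- 1 - x + k) * (- 1 - x + 1 - k)) = (\<Prod>k=-int r..int r. (x + k) * (x + 1 - k))"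
      by (intro prod.cong refl) (simp add: algebra_simps)
    moreover have "(d_int (int r) k (- 1 - x))\<^sup>2 = (d_int (int r) k x)\<^sup>2" for k
      unfolding d_int_reflect by (simp add: power_mult_distrib flip: power_mult)
    ultimately show ?thesis
      using congruence_beyond_r[OF assms 2] by (simp only: cong_0_iff)
  next
    case 3
    \<comment> \<open>The factor \<open>x + k\<close> vanishes at \<open>k = - x\<close>, except
      when \<open>x = - r - 1\<close>, where \<open>x + 1 - k\<close> vanishes at
      \<open>k = - r\<close>.\<close>
    then have "\<exists>k\<in>{- int r..int r}. (x + k) * (x + 1 - k) = 0"
    proof (cases "x = - int r - 1")
      case True
      then show ?thesis by (intro bexI[of _ "- int r"]) auto
    next
      case False
      then show ?thesis using 3 by (intro bexI[of _ "- x"]) auto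
    qed
    then have "(\<Prod>k=-int r..int r. (x + k) * (x + 1 - k)) = 0"
      by (simp add: prod_zero_iff)
    then show ?thesis by (simp only: mult_zero_left mult_zero_right cong_refl)
  qed
qed

end
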